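(* Let $S$ be a $\Gamma$-semigroup with unities, let $L$ be its left operator semigroup, and let $Q$ be any non-empty set. If $\eta$ is a $Q$-fuzzy ideal (respectively $Q$-fuzzy right ideal) of $S$, then $\eta^{+'}$ is a $Q$-fuzzy ideal (respectively $Q$-fuzzy right ideal) of $L$.
   Context: $\Gamma$-semigroup: non-empty sets $S$ and $\Gamma$ together with mappings $S\times\Gamma\times S\to S$, $(a,\alpha,b)\mapsto a\alpha b$, and $\Gamma\times S\times\Gamma\to\Gamma$, $(\alpha,a,\beta)\mapsto\alpha a\beta$, such that $(a\alpha b)\beta c=a(\alpha b\beta)c=a\alpha(b\beta c)$ and $\alpha(a\beta b)\gamma=(\alpha a\beta)b\gamma=\alpha a(\beta b\gamma)$ for all $a,b,c\in S$ and $\alpha,\beta,\gamma\in\Gamma$; one says $S$ is a $\Gamma$-semigroup. Operator semigroups: on $S\times\Gamma$ define the equivalence relation $(x,\alpha)\rho(y,\beta)$ iff $x\alpha s=y\beta s$ for all $s\in S$ and $\gamma x\alpha=\gamma y\beta$ for all $\gamma\in\Gamma$; write $[x,\alpha]$ for the class of $(x,\alpha)$. The left operator semigroup is $L=\{[x,\alpha]:x\in S,\alpha\in\Gamma\}$ with multiplication $[x,\alpha][y,\beta]=[x\alpha y,\beta]$. Dually, the right operator semigroup $R$ consists of the classes $[\alpha,a]$ of pairs in $\Gamma\times S$ under the relation $(\alpha,a)\sim(\beta,b)$ iff $s\alpha a=s\beta b$ for all $s\in S$ and $\alpha a\gamma=\beta b\gamma$ for all $\gamma\in\Gamma$, with multiplication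 $[\alpha,a][\beta,b]=[\alpha a\beta,b]$. A left unity of $S$ is an element $[e,\delta]\in L$ with $e\delta s=s$ for all $s\in S$; a right unity of $S$ is an element $[\gamma,f]\in R$ with $s\gamma f=s$ for all $s\in S$. "$S$ with unities" means that $S$ has a left unity and a right unity. A $Q$-fuzzy subset of a non-empty set $X$ is a function $\mu:X\times Q\to[0,1]$; it is non-empty if it is not identically $0$. A non-empty $Q$-fuzzy subset $\mu$ of $S$ is a $Q$-fuzzy left (right) ideal of $S$ if $\mu(x\gamma y,q)\ge\mu(y,q)$ (respectively $\ge\mu(x,q)$) for all $x,y\in S,\gamma\in\Gamma,q\in Q$, and a $Q$-fuzzy ideal if it is both. For a semigroup $T$ (such as $L$), a non-empty $Q$-fuzzy subset $\mu$ of $T$ is a $Q$-fuzzy left (right) ideal of $T$ if $\mu(xy,q)\ge\mu(y,q)$ (respectively $\ge\mu(x,q)$) for all $x,y\in T,q\in Q$, and a $Q$-fuzzy ideal if it is both. For a $Q$-fuzzy subset $\eta$ of $S$, the $Q$-fuzzy subset $\eta^{+'}$ of $L$ is $\eta^{+'}([a,\alpha],q)=\inf_{s\in S}\eta(a\alpha s,q)$. *)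

theory Defs
  imports Complex_Main "HOL-Library.FuncSet"
begin

record ('s, 'g) gamma_struct =
  scar :: "'s set"
  gcar :: "'g set"
  smul :: "'s \<Rightarrow> 'g \<Rightarrow> 's \<Rightarrow> 's"
  gmul :: "'g \<Rightarrow> 's \<Rightarrow> 'g \<Rightarrow> 'g"

locale gamma_semigroup =
  fixes M :: "('s, 'g) gamma_struct"
  assumes scar_nonempty: "scar M \<noteq> {}"
    and gcar_nonempty: "gcar M \<noteq> {}"
    and smul_closed: "\<And>a \<alpha> b. \<lbrakk>a \<in> scar M; \<alpha> \<in> gcar M; b \<in> scar M\<rbrakk> \<Longrightarrow> smul M a \<alpha> b \<in> scar M"
    and gmul_closed: "\<And>\<alpha> a \<beta>. \<lbrakk>\<alpha> \<in> gcar M; a \<in> scar M; \<beta> \<in> gcar M\<rbrakk> \<Longrightarrow> gmul M \<alpha> a \<beta> \<in> gcar M"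
    and smul_assoc1: "\<And>a \<alpha> b \<beta> c. \<lbrakk>a \<in> scar M; \<alpha> \<in> gcar M; b \<in> scar M; \<beta> \<in> gcar M; c \<in> scar M\<rbrakk>
          \<Longrightarrow> smul M (smul M a \<alpha> b) \<beta> c = smul M a (gmul M \<alpha> b \<beta>) c"
    and smul_assoc2: "\<And>a \<alpha> b \<beta> c. \<lbrakk>a \<in> scar M; \<alpha> \<in> gcar M; b \<in> scar M; \<beta> \<in> gcar M; c \<in> scar M\<rbrakk>
          \<Longrightarrow> smul M a (gmul M \<alpha> b \<beta>) c = smul M a \<alpha> (smul M b \<beta> c)"
    and gmul_assoc1: "\<And>\<alpha> a \<beta> b \<gamma>. \<lbrakk>\<alpha> \<in> gcar M; a \<in> scar M; \<beta> \<in> gcar M; b \<in> scar M; \<gamma> \<in> gcar M\<rbrakk>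
          \<Longrightarrow> gmul M \<alpha> (smul M a \<beta> b) \<gamma> = gmul M (gmul M \<alpha> a \<beta>) b \<gamma>"
    and gmul_assoc2: "\<And>\<alpha> a \<beta> b \<gamma>. \<lbrakk>\<alpha> \<in> gcar M; a \<in> scar M; \<beta> \<in> gcar M; b \<in> scar M; \<gamma> \<in> gcar M\<rbrakk>
          \<Longrightarrow> gmul M (gmul M \<alpha> a \<beta>) b \<gamma> = gmul M \<alpha> a (gmul M \<beta> b \<gamma>)"

definition left_rel :: "('s, 'g) gamma_struct \<Rightarrow> (('s \<times> 'g) \<times> ('s \<times> 'g)) set" where
  "left_rel M = {((x, \<alpha>), (y, \<beta>)). x \<in> scar M \<and> \<alpha> \<in> gcar M \<and> y \<in> scar M \<and> \<beta> \<in> gcar M \<and>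
     (\<forall>s\<in>scar M. smul M x \<alpha> s = smul M y \<beta> s) \<and> (\<forall>\<gamma>\<in>gcar M. gmul M \<gamma> x \<alpha> = gmul M \<gamma> y \<beta>)}"

definition right_rel :: "('s, 'g) gamma_struct \<Rightarrow> (('g \<times> 's) \<times> ('g \<times> 's)) set" where
  "right_rel M = {((\<alpha>, a), (\<beta>, b)). \<alpha> \<in> gcar M \<and> a \<in> scar M \<and> \<beta> \<in> gcar M \<and> b \<in> scar M \<and>
     (\<forall>s\<in>scar M. smul M s \<alpha> a = smul M s \<beta> b) \<and> (\<forall>\<gamma>\<in>gcar M. gmul M \<alpha> a \<gamma> = gmul M \<beta> b \<gamma>)}"

definition left_class :: "('s, 'g) gamma_struct \<Rightarrow> 's \<Rightarrow> 'g \<Rightarrow> ('s \<times> 'g) set" where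
  "left_class M x \<alpha> = left_rel M `` {(x, \<alpha>)}"

definition right_class :: "('s, 'g) gamma_struct \<Rightarrow> 'g \<Rightarrow> 's \<Rightarrow> ('g \<times> 's) set" where
  "right_class M \<alpha> a = right_rel M `` {(\<alpha>, a)}"

definition left_op :: "('s, 'g) gamma_struct \<Rightarrow> ('s \<times> 'g) set set" where
  "left_op M = (scar M \<times> gcar M) // left_rel M"

definition right_op :: "('s, 'g) gamma_struct \<Rightarrow> ('g \<times> 's) set set" where
  "right_op M = (gcar M \<times> scar M) // right_rel M"

text \<open>All classes occurring in the union coincide, so it is the single class of the products of
  representatives; see \<open>left_mult_class\<close> below.\<close>

definition left_mult ::
    "('s, 'g) gamma_struct \<Rightarrow> ('s \<times> 'g) set \<Rightarrow> ('s \<times> 'g) set \<Rightarrow> ('s \<times> 'g) set" where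
  "left_mult M A B = (\<Union>(x, \<alpha>)\<in>A. \<Union>(y, \<beta>)\<in>B. left_class M (smul M x \<alpha> y) \<beta>)"

definition left_unity :: "('s, 'g) gamma_struct \<Rightarrow> ('s \<times> 'g) set \<Rightarrow> bool" where
  "left_unity M A \<longleftrightarrow> A \<in> left_op M \<and>
     (\<exists>e\<in>scar M. \<exists>\<delta>\<in>gcar M. A = left_class M e \<delta> \<and> (\<forall>s\<in>scar M. smul M e \<delta> s = s))"

definition right_unity :: "('s, 'g) gamma_struct \<Rightarrow> ('g \<times> 's) set \<Rightarrow> bool" where
  "right_unity M A \<longleftrightarrow> A \<in> right_op M \<and>
     (\<exists>\<gamma>\<in>gcar M. \<exists>f\<in>scar M. A = right_class M \<gamma> f \<and> (\<forall>s\<in>scar M. smul M s \<gamma> f = s))"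

definition with_unities :: "('s, 'g) gamma_struct \<Rightarrow> bool" where
  "with_unities M \<longleftrightarrow> (\<exists>A. left_unity M A) \<and> (\<exists>B. right_unity M B)"

text \<open>Only the values on \<open>X \<times> Q\<close> matter.\<close>

definition fuzzy_subset :: "'q set \<Rightarrow> 'x set \<Rightarrow> ('x \<times> 'q \<Rightarrow> real) \<Rightarrow> bool" where
  "fuzzy_subset Q X \<mu> \<longleftrightarrow> \<mu> \<in> X \<times> Q \<rightarrow> {0..1}"

definition nonempty_fuzzy_subset :: "'q set \<Rightarrow> 'x set \<Rightarrow> ('x \<times> 'q \<Rightarrow> real) \<Rightarrow> bool" where
  "nonempty_fuzzy_subset Q X \<mu> \<longleftrightarrow> fuzzy_subset Q X \<mu> \<and> (\<exists>x\<in>X. \<exists>q\<in>Q. \<mu> (x, q) \<noteq> 0)"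

definition gamma_fuzzy_left_ideal ::
    "'q set \<Rightarrow> ('s, 'g) gamma_struct \<Rightarrow> ('s \<times> 'q \<Rightarrow> real) \<Rightarrow> bool" where
  "gamma_fuzzy_left_ideal Q M \<mu> \<longleftrightarrow> nonempty_fuzzy_subset Q (scar M) \<mu> \<and>
     (\<forall>x\<in>scar M. \<forall>\<gamma>\<in>gcar M. \<forall>y\<in>scar M. \<forall>q\<in>Q. \<mu> (smul M x \<gamma> y, q) \<ge> \<mu> (y, q))"

definition gamma_fuzzy_right_ideal ::
    "'q set \<Rightarrow> ('s, 'g) gamma_struct \<Rightarrow> ('s \<times> 'q \<Rightarrow> real) \<Rightarrow> bool" where
  "gamma_fuzzy_right_ideal Q M \<mu> \<longleftrightarrow> nonempty_fuzzy_subset Q (scar M) \<mu> \<and>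
     (\<forall>x\<in>scar M. \<forall>\<gamma>\<in>gcar M. \<forall>y\<in>scar M. \<forall>q\<in>Q. \<mu> (smul M x \<gamma> y, q) \<ge> \<mu> (x, q))"

definition gamma_fuzzy_ideal ::
    "'q set \<Rightarrow> ('s, 'g) gamma_struct \<Rightarrow> ('s \<times> 'q \<Rightarrow> real) \<Rightarrow> bool" where
  "gamma_fuzzy_ideal Q M \<mu> \<longleftrightarrow> gamma_fuzzy_left_ideal Q M \<mu> \<and> gamma_fuzzy_right_ideal Q M \<mu>"

text \<open>Fuzzy ideals of a semigroup with carrier \<open>T\<close> and multiplication \<open>m\<close>.\<close>

definition sg_fuzzy_left_ideal ::
    "'q set \<Rightarrow> 't set \<Rightarrow> ('t \<Rightarrow> 't \<Rightarrow> 't) \<Rightarrow> ('t \<times> 'q \<Rightarrow> real) \<Rightarrow> bool" where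
  "sg_fuzzy_left_ideal Q T m \<mu> \<longleftrightarrow> nonempty_fuzzy_subset Q T \<mu> \<and>
     (\<forall>x\<in>T. \<forall>y\<in>T. \<forall>q\<in>Q. \<mu> (m x y, q) \<ge> \<mu> (y, q))"

definition sg_fuzzy_right_ideal ::
    "'q set \<Rightarrow> 't set \<Rightarrow> ('t \<Rightarrow> 't \<Rightarrow> 't) \<Rightarrow> ('t \<times> 'q \<Rightarrow> real) \<Rightarrow> bool" where
  "sg_fuzzy_right_ideal Q T m \<mu> \<longleftrightarrow> nonempty_fuzzy_subset Q T \<mu> \<and>
     (\<forall>x\<in>T. \<forall>y\<in>T. \<forall>q\<in>Q. \<mu> (m x y, q) \<ge> \<mu> (x, q))"

definition sg_fuzzy_ideal ::
    "'q set \<Rightarrow> 't set \<Rightarrow> ('t \<Rightarrow> 't \<Rightarrow> 't) \<Rightarrow> ('t \<times> 'q \<Rightarrow> real) \<Rightarrow> bool" where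
  "sg_fuzzy_ideal Q T m \<mu> \<longleftrightarrow> sg_fuzzy_left_ideal Q T m \<mu> \<and> sg_fuzzy_right_ideal Q T m \<mu>"

text \<open>\<open>\<eta>\<^sup>+\<^sup>'\<close>: the value at a class is the common value of the infimum over all of its
  representatives; \<open>plus_prime_class\<close> below gives the defining formula.\<close>

definition plus_prime ::
    "('s, 'g) gamma_struct \<Rightarrow> ('s \<times> 'q \<Rightarrow> real) \<Rightarrow> ('s \<times> 'g) set \<times> 'q \<Rightarrow> real" where
  "plus_prime M \<eta> = (\<lambda>(A, q). THE r. \<forall>(a, \<alpha>)\<in>A. r = (INF s\<in>scar M. \<eta> (smul M a \<alpha> s, q)))"

lemma equiv_left_rel: "equiv (scar M \<times> gcar M) (left_rel M)"
  by (rule equivI) (auto simp: left_rel_def refl_on_def sym_def trans_def)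

lemma equiv_right_rel: "equiv (gcar M \<times> scar M) (right_rel M)"
  by (rule equivI) (auto simp: right_rel_def refl_on_def sym_def trans_def)

lemma left_op_iff: "A \<in> left_op M \<longleftrightarrow> (\<exists>x\<in>scar M. \<exists>\<alpha>\<in>gcar M. A = left_class M x \<alpha>)"
  by (auto simp: left_op_def left_class_def quotient_def)

lemma left_class_self: "x \<in> scar M \<Longrightarrow> \<alpha> \<in> gcar M \<Longrightarrow> (x, \<alpha>) \<in> left_class M x \<alpha>"
  by (auto simp: left_class_def left_rel_def)

lemma plus_prime_class:
  assumes "a \<in> scar M" "\<alpha> \<in> gcar M"
  shows "plus_prime M \<eta> (left_class M a \<alpha>, q) = (INF s\<in>scar M. \<eta> (smul M a \<alpha> s, q))"
proof -
  let ?r = "INF s\<in>scar M. \<eta> (smul M a \<alpha> s, q)"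
  have eq: "(INF s\<in>scar M. \<eta> (smul M b \<beta> s, q)) = ?r"
    if "(b, \<beta>) \<in> left_class M a \<alpha>" for b \<beta>
    using that by (intro arg_cong[where f = Inf] image_cong) (auto simp: left_class_def left_rel_def)
  show ?thesis
    unfolding plus_prime_def prod.case
  proof (rule the_equality)
    show "\<forall>(b, \<beta>)\<in>left_class M a \<alpha>. ?r = (INF s\<in>scar M. \<eta> (smul M b \<beta> s, q))"
    proof (intro ballI, clarify)
      fix b \<beta> assume "(b, \<beta>) \<in> left_class M a \<alpha>"
      then show "?r = (INF s\<in>scar M. \<eta> (smul M b \<beta> s, q))"
        by (rule eq[symmetric])
    qed
  next
    fix r
    assume "\<forall>(b, \<beta>)\<in>left_class M a \<alpha>. r = (INF s\<in>scar M. \<eta> (smul M b \<beta> s, q))"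
    from bspec[OF this left_class_self[OF assms]] show "r = ?r"
      by (simp only: prod.case)
  qed
qed

context gamma_semigroup
begin

lemma left_mult_class:
  assumes x: "x \<in> scar M" "\<alpha> \<in> gcar M" and y: "y \<in> scar M" "\<beta> \<in> gcar M"
  shows "left_mult M (left_class M x \<alpha>) (left_class M y \<beta>) = left_class M (smul M x \<alpha> y) \<beta>"
proof -
  have "left_class M (smul M x' \<alpha>' y') \<beta>' = left_class M (smul M x \<alpha> y) \<beta>"
    if "(x', \<alpha>') \<in> left_class M x \<alpha>" "(y', \<beta>') \<in> left_class M y \<beta>" for x' \<alpha>' y' \<beta>'
  proof -
    have c: "x' \<in> scar M" "\<alpha>' \<in> gcar M" "y' \<in> scar M" "\<beta>' \<in> gcar M"
      and ex: "\<And>s. s \<in> scar M \<Longrightarrow> smul M x \<alpha> s = smul M x' \<alpha>' s"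
              "\<And>\<gamma>. \<gamma> \<in> gcar M \<Longrightarrow> gmul M \<gamma> x \<alpha> = gmul M \<gamma> x' \<alpha>'"
      and ey: "\<And>s. s \<in> scar M \<Longrightarrow> smul M y \<beta> s = smul M y' \<beta>' s"
              "\<And>\<gamma>. \<gamma> \<in> gcar M \<Longrightarrow> gmul M \<gamma> y \<beta> = gmul M \<gamma> y' \<beta>'"
      using that by (auto simp: left_class_def left_rel_def)
    have 1: "smul M (smul M x' \<alpha>' y') \<beta>' s = smul M (smul M x \<alpha> y) \<beta> s" if "s \<in> scar M" for s
      using that x y c ex ey by (simp add: smul_assoc1 smul_assoc2 smul_closed)
    have 2: "gmul M \<gamma> (smul M x' \<alpha>' y') \<beta>' = gmul M \<gamma> (smul M x \<alpha> y) \<beta>" if "\<gamma> \<in> gcar M" for \<gamma>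
    proof -
      have "gmul M \<gamma> (smul M x' \<alpha>' y') \<beta>' = gmul M (gmul M \<gamma> x' \<alpha>') y' \<beta>'"
        using that c by (simp add: gmul_assoc1)
      also have "\<dots> = gmul M (gmul M \<gamma> x \<alpha>) y \<beta>"
        using that x c ex(2) ey(2) by (simp add: gmul_closed)
      also have "\<dots> = gmul M \<gamma> (smul M x \<alpha> y) \<beta>"
        using that x y by (simp add: gmul_assoc1)
      finally show ?thesis .
    qed
    have "((smul M x' \<alpha>' y', \<beta>'), (smul M x \<alpha> y, \<beta>)) \<in> left_rel M"
      using 1 2 x y c by (auto simp: left_rel_def smul_closed)
    then show ?thesis
      unfolding left_class_def by (rule equiv_class_eq[OF equiv_left_rel])
  qed
  then have "left_mult M (left_class M x \<alpha>) (left_class M y \<beta>) =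
      (\<Union>p\<in>left_class M x \<alpha>. \<Union>r\<in>left_class M y \<beta>. left_class M (smul M x \<alpha> y) \<beta>)"
    unfolding left_mult_def by (intro SUP_cong refl) (auto split: prod.split)
  also have "\<dots> = left_class M (smul M x \<alpha> y) \<beta>"
    using left_class_self[OF x] left_class_self[OF y] by auto
  finally show ?thesis .
qed

lemma left_mult_closed:
  assumes "A \<in> left_op M" "B \<in> left_op M"
  shows "left_mult M A B \<in> left_op M"
proof -
  from assms obtain x \<alpha> y \<beta>
    where x: "x \<in> scar M" "\<alpha> \<in> gcar M" "A = left_class M x \<alpha>"
      and y: "y \<in> scar M" "\<beta> \<in> gcar M" "B = left_class M y \<beta>"
    unfolding left_op_iff by blast
  then have "left_mult M A B = left_class M (smul M x \<alpha> y) \<beta>"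
    by (simp add: left_mult_class)
  moreover have "smul M x \<alpha> y \<in> scar M"
    using x y by (simp add: smul_closed)
  ultimately show ?thesis
    using y(2) unfolding left_op_iff by blast
qed

lemma left_mult_assoc:
  assumes "A \<in> left_op M" "B \<in> left_op M" "C \<in> left_op M"
  shows "left_mult M (left_mult M A B) C = left_mult M A (left_mult M B C)"
proof -
  from assms obtain x \<alpha> y \<beta> z \<gamma>
    where x: "x \<in> scar M" "\<alpha> \<in> gcar M" "A = left_class M x \<alpha>"
      and y: "y \<in> scar M" "\<beta> \<in> gcar M" "B = left_class M y \<beta>"
      and z: "z \<in> scar M" "\<gamma> \<in> gcar M" "C = left_class M z \<gamma>"
    unfolding left_op_iff by blast
  then show ?thesis
    by (simp add: left_mult_class smul_closed smul_assoc1 smul_assoc2)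
qed

end

end

theory Submission
  imports Defs
begin

text \<open>For A = [x,\<alpha>] and B = [y,\<beta>], associativity gives (x\<alpha>y)\<beta>s =
  x\<alpha>(y\<beta>s). Hence the infimum defining the value at AB runs over some of the translates
  x\<alpha>t that define the value at A, namely those with t = y\<beta>s, and so is at least the
  value at A (\<open>plus_prime_left_mult_ge_left\<close>). If \<eta> is a left ideal, each
  \<eta>(x\<alpha>(y\<beta>s)) also dominates \<eta>(y\<beta>s), hence the value at B
  (\<open>plus_prime_left_mult_ge_right\<close>). The right ideal property keeps the new fuzzy
  subset from vanishing identically (\<open>nonempty_fuzzy_subset_plus_prime\<close>).\<close>

context gamma_semigroup
begin

text \<open>The reals are only conditionally complete, so an infimum is known to be a lower bound
  only once the set is bounded below; here 0 serves.\<close>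

lemma bdd_below_fuzzy_translates:
  assumes "fuzzy_subset Q (scar M) \<eta>" "a \<in> scar M" "\<alpha> \<in> gcar M" "q \<in> Q"
  shows "bdd_below ((\<lambda>s. \<eta> (smul M a \<alpha> s, q)) ` scar M)"
  using assms smul_closed by (intro bdd_belowI[of _ 0]) (fastforce simp: fuzzy_subset_def)

lemma plus_prime_lower:
  assumes "fuzzy_subset Q (scar M) \<eta>" "a \<in> scar M" "\<alpha> \<in> gcar M" "q \<in> Q" "s \<in> scar M"
  shows "plus_prime M \<eta> (left_class M a \<alpha>, q) \<le> \<eta> (smul M a \<alpha> s, q)"
  unfolding plus_prime_class[OF assms(2,3)]
  using bdd_below_fuzzy_translates[OF assms(1-4)] assms(5) by (rule cINF_lower)

lemma plus_prime_greatest: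
  assumes "a \<in> scar M" "\<alpha> \<in> gcar M"
    and "\<And>s. s \<in> scar M \<Longrightarrow> c \<le> \<eta> (smul M a \<alpha> s, q)"
  shows "c \<le> plus_prime M \<eta> (left_class M a \<alpha>, q)"
  unfolding plus_prime_class[OF assms(1,2)]
  using scar_nonempty assms(3) by (rule cINF_greatest)

lemma fuzzy_subset_plus_prime:
  assumes \<eta>: "fuzzy_subset Q (scar M) \<eta>"
  shows "fuzzy_subset Q (left_op M) (plus_prime M \<eta>)"
proof -
  have "plus_prime M \<eta> (left_class M a \<alpha>, q) \<in> {0..1}"
    if a: "a \<in> scar M" "\<alpha> \<in> gcar M" and q: "q \<in> Q" for a \<alpha> q
  proof -
    have range: "0 \<le> \<eta> (smul M a \<alpha> s, q) \<and> \<eta> (smul M a \<alpha> s, q) \<le> 1" if "s \<in> scar M" for s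
      using \<eta> a q that smul_closed by (fastforce simp: fuzzy_subset_def)
    \<comment> \<open>The bound by 1 needs a single translate, since the infimum lies below each of
      them.\<close>
    obtain s where s: "s \<in> scar M"
      using scar_nonempty by blast
    have "0 \<le> plus_prime M \<eta> (left_class M a \<alpha>, q)"
      using a range by (intro plus_prime_greatest) auto
    moreover have "plus_prime M \<eta> (left_class M a \<alpha>, q) \<le> 1"
      using plus_prime_lower[OF \<eta> a q s] range[OF s] by linarith
    ultimately show ?thesis by simp
  qed
  then show ?thesis
    by (auto simp: fuzzy_subset_def left_op_iff)
qed

text \<open>An infimum of positive numbers may be 0, so a uniform bound is needed: where \<eta>(x,q)
  is nonzero, the right ideal property puts every \<eta>(x\<gamma>s,q) above this fixed positive
  number.\<close>

lemma nonempty_fuzzy_subset_plus_prime: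
  assumes "gamma_fuzzy_right_ideal Q M \<eta>"
  shows "nonempty_fuzzy_subset Q (left_op M) (plus_prime M \<eta>)"
proof -
  have \<eta>: "fuzzy_subset Q (scar M) \<eta>"
    and right: "\<And>x \<gamma> y q. \<lbrakk>x \<in> scar M; \<gamma> \<in> gcar M; y \<in> scar M; q \<in> Q\<rbrakk>
      \<Longrightarrow> \<eta> (x, q) \<le> \<eta> (smul M x \<gamma> y, q)"
    using assms by (auto simp: gamma_fuzzy_right_ideal_def nonempty_fuzzy_subset_def)
  obtain x q where x: "x \<in> scar M" and q: "q \<in> Q" and nz: "\<eta> (x, q) \<noteq> 0"
    using assms by (auto simp: gamma_fuzzy_right_ideal_def nonempty_fuzzy_subset_def)
  obtain \<gamma> where \<gamma>: "\<gamma> \<in> gcar M"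
    using gcar_nonempty by blast
  have "0 < \<eta> (x, q)"
    using \<eta> x q nz by (force simp: fuzzy_subset_def)
  also have "\<dots> \<le> plus_prime M \<eta> (left_class M x \<gamma>, q)"
    using x \<gamma> right q by (intro plus_prime_greatest) auto
  finally have "plus_prime M \<eta> (left_class M x \<gamma>, q) \<noteq> 0" by simp
  moreover have "left_class M x \<gamma> \<in> left_op M"
    using x \<gamma> by (auto simp: left_op_iff)
  ultimately show ?thesis
    using fuzzy_subset_plus_prime[OF \<eta>] q by (auto simp: nonempty_fuzzy_subset_def)
qed

lemma plus_prime_left_mult_ge_left:
  assumes \<eta>: "fuzzy_subset Q (scar M) \<eta>"
    and A: "A \<in> left_op M" and B: "B \<in> left_op M" and q: "q \<in> Q"
  shows "plus_prime M \<eta> (A, q) \<le> plus_prime M \<eta> (left_mult M A B, q)"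
proof -
  obtain x \<alpha> y \<beta>
    where x: "x \<in> scar M" "\<alpha> \<in> gcar M" "A = left_class M x \<alpha>"
      and y: "y \<in> scar M" "\<beta> \<in> gcar M" "B = left_class M y \<beta>"
    using A B unfolding left_op_iff by blast
  have "plus_prime M \<eta> (A, q) \<le> \<eta> (smul M (smul M x \<alpha> y) \<beta> s, q)" if "s \<in> scar M" for s
    \<comment> \<open>The translate of [x,\<alpha>] at y\<beta>s is the translate of the product
      class at s.\<close>
    using plus_prime_lower[OF \<eta> x(1,2) q, of "smul M y \<beta> s"] x y that
    by (simp add: smul_closed smul_assoc1 smul_assoc2)
  then show ?thesis
    using x y by (simp add: left_mult_class smul_closed plus_prime_greatest)
qed

lemma plus_prime_left_mult_ge_right:
  assumes "gamma_fuzzy_left_ideal Q M \<eta>"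
    and A: "A \<in> left_op M" and B: "B \<in> left_op M" and q: "q \<in> Q"
  shows "plus_prime M \<eta> (B, q) \<le> plus_prime M \<eta> (left_mult M A B, q)"
proof -
  have \<eta>: "fuzzy_subset Q (scar M) \<eta>"
    and left: "\<And>x \<gamma> y. \<lbrakk>x \<in> scar M; \<gamma> \<in> gcar M; y \<in> scar M\<rbrakk>
      \<Longrightarrow> \<eta> (y, q) \<le> \<eta> (smul M x \<gamma> y, q)"
    using assms by (auto simp: gamma_fuzzy_left_ideal_def nonempty_fuzzy_subset_def)
  obtain x \<alpha> y \<beta>
    where x: "x \<in> scar M" "\<alpha> \<in> gcar M" "A = left_class M x \<alpha>"
      and y: "y \<in> scar M" "\<beta> \<in> gcar M" "B = left_class M y \<beta>"
    using A B unfolding left_op_iff by blast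
  have "plus_prime M \<eta> (B, q) \<le> \<eta> (smul M (smul M x \<alpha> y) \<beta> s, q)" if s: "s \<in> scar M" for s
  proof -
    have "plus_prime M \<eta> (B, q) \<le> \<eta> (smul M y \<beta> s, q)"
      using plus_prime_lower[OF \<eta> y(1,2) q s] y(3) by simp
    \<comment> \<open>The left ideal property absorbs the factor x\<alpha> in front of
      y\<beta>s.\<close>
    also have "\<dots> \<le> \<eta> (smul M x \<alpha> (smul M y \<beta> s), q)"
      using x y s by (intro left) (auto intro: smul_closed)
    finally show ?thesis
      using x y s by (simp add: smul_assoc1 smul_assoc2)
  qed
  then show ?thesis
    using x y by (simp add: left_mult_class smul_closed plus_prime_greatest)
qed

lemma sg_fuzzy_right_ideal_plus_prime:
  assumes "gamma_fuzzy_right_ideal Q M \<eta>"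
  shows "sg_fuzzy_right_ideal Q (left_op M) (left_mult M) (plus_prime M \<eta>)"
proof -
  have "fuzzy_subset Q (scar M) \<eta>"
    using assms by (simp add: gamma_fuzzy_right_ideal_def nonempty_fuzzy_subset_def)
  then show ?thesis
    using nonempty_fuzzy_subset_plus_prime[OF assms] plus_prime_left_mult_ge_left
    by (auto simp: sg_fuzzy_right_ideal_def)
qed

lemma sg_fuzzy_ideal_plus_prime:
  assumes "gamma_fuzzy_ideal Q M \<eta>"
  shows "sg_fuzzy_ideal Q (left_op M) (left_mult M) (plus_prime M \<eta>)"
  \<comment> \<open>The non-emptiness demanded by the left ideal half is taken from the right ideal
    property of \<eta>.\<close>
  using assms sg_fuzzy_right_ideal_plus_prime nonempty_fuzzy_subset_plus_prime
    plus_prime_left_mult_ge_right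
  by (auto simp: sg_fuzzy_ideal_def sg_fuzzy_left_ideal_def gamma_fuzzy_ideal_def)

end

theorem proposition5p12:
  fixes M :: "('s, 'g) gamma_struct" and Q :: "'q set" and \<eta> :: "'s \<times> 'q \<Rightarrow> real"
  assumes "gamma_semigroup M" and "with_unities M" and "Q \<noteq> {}"
  shows "(gamma_fuzzy_ideal Q M \<eta> \<longrightarrow> sg_fuzzy_ideal Q (left_op M) (left_mult M) (plus_prime M \<eta>)) \<and>
         (gamma_fuzzy_right_ideal Q M \<eta> \<longrightarrow> sg_fuzzy_right_ideal Q (left_op M) (left_mult M) (plus_prime M \<eta>))"
  using gamma_semigroup.sg_fuzzy_ideal_plus_prime[OF assms(1)]
    gamma_semigroup.sg_fuzzy_right_ideal_plus_prime[OF assms(1)]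
  by blast

end
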